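(* Let $(X_n)_{n\ge0}$ be Markov chains on $(\mathbb S_n)_{n\ge0}$ with rates $(c_n)$ and down-operators $(D_n)$ satisfying the standing assumptions (A0)--(A5) of the context. There exists a sequence of constants $(q_m)_{m\ge1}$ such that $$\big\|T_n^{\lfloor tc_n\rfloor}(f)_n-(Q_tf)_n\big\|_{C(\mathbb S_n)}\le\frac{\max(1,t)}{c_n}\sum_{1\le|s|\le k}|a_s|\,q_{|s|}\,e^{-tc_{|s|-1}}$$ whenever $f=\sum_{|s|\le k}a_sh_s$, $t\ge0$ and $n\ge k$. Here $Q_t$ is the linear operator on $H=\operatorname{span}\{h_s\}_{s\in\mathbb S}$ with $Q_th_s=e^{-tc_{|s|-1}}h_s$.
   Context: $C(Z)$ is the space of real functions on the finite set $Z$ with the sup norm. A transition operator from $C(Z')$ to $C(Z)$ is a map $f\mapsto\sum_{y\in Z'}\mu(\cdot,y)f(y)$ with $\mu$ a stochastic $Z\times Z'$ matrix. $\mathbb S=\bigcup_n\mathbb S_n$; $|s|$ is the $n$ with $s\in\mathbb S_n$; $\mathbf 1_u$ is the indicator of $\{u\}$; $c_{-1}=0$; $(f)_n=f|_{\mathbb S_n}$. Assumptions. (A0) $\mathbb S_0,\mathbb S_1,\dots$ are finite and pairwise disjoint and $\mathbb S_0=\{\varnothing\}$. $T_n$ is the transition operator of the Markov chain $X_n$ on $\mathbb S_n$, $(c_n)_{n\ge0}$ are real numbers, $(D_n)_{n\ge1}$ linear operators, $A_n=c_n(T_n-I)$, and for all $n\ge0$: (A1) $0<c_n<c_{n+1}$;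 (A2) $D_{n+1}$ is a transition operator from $C(\mathbb S_n)$ to $C(\mathbb S_{n+1})$; (A3) $\operatorname{range}(A_{n+1}+c_nI)\subset\operatorname{range}D_{n+1}$; (A4) $D_{n+1}$ is injective; (A5) $A_{n+1}D_{n+1}=D_{n+1}A_n$. $U_n:C(\mathbb S_{n+1})\to C(\mathbb S_n)$ is the unique linear operator with $c_nD_{n+1}U_n=A_{n+1}+c_nI$; $p^\uparrow_{k,n}(s,u)=(U_kU_{k+1}\cdots U_{n-1}\mathbf 1_u)(s)$ for $s\in\mathbb S_k$, $u\in\mathbb S_n$, $k\le n$. For $s,u\in\mathbb S$: $d_s(u)=(D_{|u|}\cdots D_{|s|+1}\mathbf 1_s)(u)$ if $|u|\ge|s|$ ($=\mathbf 1_s(u)$ if $|u|=|s|$), and $0$ otherwise. $\eta_{i,j}=\prod_{m=i}^{j-1}\frac{c_m}{c_{m-1}-c_{j-1}}$ and $h_s=\sum_{|r|\le|s|}p^\uparrow_{|r|,|s|}(r,s)\,\eta_{|r|,|s|}\,d_r$. The functions $(h_s)_{s\in\mathbb S}$ on $\mathbb S$ are linearly independent, so $Q_t$ is well defined. *)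

theory Defs
  imports "HOL-Analysis.Analysis" "HOL-Library.Function_Algebras"
begin

definition scale_fun :: "real \<Rightarrow> ('a \<Rightarrow> real) \<Rightarrow> 'a \<Rightarrow> real" where
  "scale_fun a f = (\<lambda>x. a * f x)"

global_interpretation fun_space: vector_space "scale_fun :: real \<Rightarrow> ('a \<Rightarrow> real) \<Rightarrow> _"
  by unfold_locales (auto simp: scale_fun_def fun_eq_iff algebra_simps)

text \<open>
  A real function on a set \<open>Z\<close> is represented by its extension by zero to the whole type, so that
  equality of functions on \<open>Z\<close> is equality in HOL.
\<close>

definition fun_on :: "'a set \<Rightarrow> ('a \<Rightarrow> real) set" where
  "fun_on Z = {f. \<forall>x. x \<notin> Z \<longrightarrow> f x = 0}"

definition restr :: "'a set \<Rightarrow> ('a \<Rightarrow> real) \<Rightarrow> 'a \<Rightarrow> real" where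
  "restr Z f = (\<lambda>x. if x \<in> Z then f x else 0)"

definition sup_norm :: "'a set \<Rightarrow> ('a \<Rightarrow> real) \<Rightarrow> real" where
  "sup_norm Z f = (SUP x\<in>Z. \<bar>f x\<bar>)"

text \<open>
  Linear operators between two subspaces are extensional functions, so that an operator is
  determined by its values on its domain.
\<close>

definition linear_maps ::
    "('a \<Rightarrow> real) set \<Rightarrow> ('b \<Rightarrow> real) set \<Rightarrow> (('a \<Rightarrow> real) \<Rightarrow> ('b \<Rightarrow> real)) set" where
  "linear_maps V W = {L \<in> V \<rightarrow>\<^sub>E W.
     (\<forall>f\<in>V. \<forall>g\<in>V. L (f + g) = L f + L g) \<and>
     (\<forall>a. \<forall>f\<in>V. L (scale_fun a f) = scale_fun a (L f))}"

definition stochastic :: "'a set \<Rightarrow> 'b set \<Rightarrow> ('a \<Rightarrow> 'b \<Rightarrow> real) \<Rightarrow> bool" where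
  "stochastic Z Z' \<mu> \<longleftrightarrow> (\<forall>x\<in>Z. (\<forall>y\<in>Z'. 0 \<le> \<mu> x y) \<and> (\<Sum>y\<in>Z'. \<mu> x y) = 1)"

definition kernel_op :: "'a set \<Rightarrow> 'b set \<Rightarrow> ('a \<Rightarrow> 'b \<Rightarrow> real) \<Rightarrow> ('b \<Rightarrow> real) \<Rightarrow> 'a \<Rightarrow> real" where
  "kernel_op Z Z' \<mu> f = restr Z (\<lambda>x. \<Sum>y\<in>Z'. \<mu> x y * f y)"

text \<open>Only the action on \<^term>\<open>fun_on Z'\<close> is constrained.\<close>

definition transition_operator ::
    "'b set \<Rightarrow> 'a set \<Rightarrow> (('b \<Rightarrow> real) \<Rightarrow> ('a \<Rightarrow> real)) \<Rightarrow> bool" where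
  "transition_operator Z' Z L \<longleftrightarrow>
     (\<exists>\<mu>. stochastic Z Z' \<mu> \<and> (\<forall>f\<in>fun_on Z'. L f = kernel_op Z Z' \<mu> f))"

text \<open>
  The chain on \<open>S n\<close> is given by its transition matrix \<open>p n\<close>; \<open>D (Suc n)\<close> maps functions on \<open>S n\<close>
  to functions on \<open>S (Suc n)\<close>, and \<open>D 0\<close> is irrelevant.
\<close>

definition T_op :: "(nat \<Rightarrow> 'a set) \<Rightarrow> (nat \<Rightarrow> 'a \<Rightarrow> 'a \<Rightarrow> real) \<Rightarrow> nat \<Rightarrow> ('a \<Rightarrow> real) \<Rightarrow> 'a \<Rightarrow> real" where
  "T_op S p n = kernel_op (S n) (S n) (p n)"

definition A_op :: "(nat \<Rightarrow> 'a set) \<Rightarrow> (nat \<Rightarrow> 'a \<Rightarrow> 'a \<Rightarrow> real) \<Rightarrow> (nat \<Rightarrow> real) \<Rightarrow>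
    nat \<Rightarrow> ('a \<Rightarrow> real) \<Rightarrow> 'a \<Rightarrow> real" where
  "A_op S p c n f = scale_fun (c n) (T_op S p n f - f)"

locale down_chains =
  fixes S :: "nat \<Rightarrow> 'a set"
    and p :: "nat \<Rightarrow> 'a \<Rightarrow> 'a \<Rightarrow> real"
    and c :: "nat \<Rightarrow> real"
    and D :: "nat \<Rightarrow> ('a \<Rightarrow> real) \<Rightarrow> 'a \<Rightarrow> real"
  assumes A0_finite: "finite (S n)"
    and A0_disjoint: "m \<noteq> n \<Longrightarrow> S m \<inter> S n = {}"
    and A0_root: "is_singleton (S 0)"
    and chain: "stochastic (S n) (S n) (p n)"
    and A1: "0 < c n" "c n < c (Suc n)"
    and A2: "transition_operator (S n) (S (Suc n)) (D (Suc n))"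
    and A3: "(\<lambda>f. A_op S p c (Suc n) f + scale_fun (c n) f) ` fun_on (S (Suc n))
               \<subseteq> D (Suc n) ` fun_on (S n)"
    and A4: "inj_on (D (Suc n)) (fun_on (S n))"
    and A5: "\<forall>f\<in>fun_on (S n). A_op S p c (Suc n) (D (Suc n) f) = D (Suc n) (A_op S p c n f)"

definition U_op :: "(nat \<Rightarrow> 'a set) \<Rightarrow> (nat \<Rightarrow> 'a \<Rightarrow> 'a \<Rightarrow> real) \<Rightarrow> (nat \<Rightarrow> real) \<Rightarrow>
    (nat \<Rightarrow> ('a \<Rightarrow> real) \<Rightarrow> 'a \<Rightarrow> real) \<Rightarrow> nat \<Rightarrow> ('a \<Rightarrow> real) \<Rightarrow> 'a \<Rightarrow> real" where
  "U_op S p c D n = (THE U. U \<in> linear_maps (fun_on (S (Suc n))) (fun_on (S n)) \<and>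
     (\<forall>f\<in>fun_on (S (Suc n)).
        scale_fun (c n) (D (Suc n) (U f)) = A_op S p c (Suc n) f + scale_fun (c n) f))"

definition p_up :: "(nat \<Rightarrow> 'a set) \<Rightarrow> (nat \<Rightarrow> 'a \<Rightarrow> 'a \<Rightarrow> real) \<Rightarrow> (nat \<Rightarrow> real) \<Rightarrow>
    (nat \<Rightarrow> ('a \<Rightarrow> real) \<Rightarrow> 'a \<Rightarrow> real) \<Rightarrow> nat \<Rightarrow> nat \<Rightarrow> 'a \<Rightarrow> 'a \<Rightarrow> real" where
  "p_up S p c D k n s u = foldr (U_op S p c D) [k..<n] (indicator {u}) s"

definition level :: "(nat \<Rightarrow> 'a set) \<Rightarrow> 'a \<Rightarrow> nat" where
  "level S s = (THE n. s \<in> S n)"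

definition d_fun :: "(nat \<Rightarrow> 'a set) \<Rightarrow> (nat \<Rightarrow> ('a \<Rightarrow> real) \<Rightarrow> 'a \<Rightarrow> real) \<Rightarrow> 'a \<Rightarrow> 'a \<Rightarrow> real" where
  "d_fun S D s u =
     (if u \<in> (\<Union>n. S n) \<and> level S s \<le> level S u
      then fold D [Suc (level S s)..<Suc (level S u)] (indicator {s}) u else 0)"

text \<open>\<open>prev_rate c m\<close> is $c_{m-1}$ with $c_{-1} = 0$.\<close>

definition prev_rate :: "(nat \<Rightarrow> real) \<Rightarrow> nat \<Rightarrow> real" where
  "prev_rate c m = (case m of 0 \<Rightarrow> 0 | Suc k \<Rightarrow> c k)"

definition eta :: "(nat \<Rightarrow> real) \<Rightarrow> nat \<Rightarrow> nat \<Rightarrow> real" where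
  "eta c i j = (\<Prod>m=i..<j. c m / (prev_rate c m - prev_rate c j))"

definition h_fun :: "(nat \<Rightarrow> 'a set) \<Rightarrow> (nat \<Rightarrow> 'a \<Rightarrow> 'a \<Rightarrow> real) \<Rightarrow> (nat \<Rightarrow> real) \<Rightarrow>
    (nat \<Rightarrow> ('a \<Rightarrow> real) \<Rightarrow> 'a \<Rightarrow> real) \<Rightarrow> 'a \<Rightarrow> 'a \<Rightarrow> real" where
  "h_fun S p c D s u =
     (\<Sum>r\<in>(\<Union>m\<le>level S s. S m).
        p_up S p c D (level S r) (level S s) r s * eta c (level S r) (level S s) * d_fun S D r u)"

definition H_space :: "(nat \<Rightarrow> 'a set) \<Rightarrow> (nat \<Rightarrow> 'a \<Rightarrow> 'a \<Rightarrow> real) \<Rightarrow> (nat \<Rightarrow> real) \<Rightarrow>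
    (nat \<Rightarrow> ('a \<Rightarrow> real) \<Rightarrow> 'a \<Rightarrow> real) \<Rightarrow> ('a \<Rightarrow> real) set" where
  "H_space S p c D = fun_space.span (h_fun S p c D ` (\<Union>n. S n))"

definition Q_op :: "(nat \<Rightarrow> 'a set) \<Rightarrow> (nat \<Rightarrow> 'a \<Rightarrow> 'a \<Rightarrow> real) \<Rightarrow> (nat \<Rightarrow> real) \<Rightarrow>
    (nat \<Rightarrow> ('a \<Rightarrow> real) \<Rightarrow> 'a \<Rightarrow> real) \<Rightarrow> real \<Rightarrow> ('a \<Rightarrow> real) \<Rightarrow> 'a \<Rightarrow> real" where
  "Q_op S p c D t = (THE Q. Q \<in> linear_maps (H_space S p c D) (H_space S p c D) \<and>
     (\<forall>s\<in>(\<Union>n. S n). Q (h_fun S p c D s) =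
        scale_fun (exp (- t * prev_rate c (level S s))) (h_fun S p c D s)))"

text \<open>
  The definite descriptions in \<^const>\<open>U_op\<close> and \<^const>\<open>Q_op\<close> are well defined; see \<open>ex1_U\<close>
  and \<open>ex1_Q\<close> below, the latter by linear independence of the functions \<open>h_fun S p c D s\<close>.
\<close>

lemma linear_maps_eqI:
  assumes "L \<in> linear_maps V W" "L' \<in> linear_maps V W" "\<And>f. f \<in> V \<Longrightarrow> L f = L' f"
  shows "L = L'"
proof (rule PiE_ext[where k = V and s = "\<lambda>_. W"])
  show "L \<in> V \<rightarrow>\<^sub>E W" "L' \<in> V \<rightarrow>\<^sub>E W" using assms(1,2) by (simp_all add: linear_maps_def)
qed (rule assms(3))

lemma fun_on_add: "f \<in> fun_on Z \<Longrightarrow> g \<in> fun_on Z \<Longrightarrow> f + g \<in> fun_on Z"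
  and fun_on_scale: "f \<in> fun_on Z \<Longrightarrow> scale_fun a f \<in> fun_on Z"
  by (auto simp: fun_on_def scale_fun_def)

lemma kernel_op_add: "kernel_op Z Z' \<mu> (f + g) = kernel_op Z Z' \<mu> f + kernel_op Z Z' \<mu> g"
  by (auto simp: kernel_op_def restr_def fun_eq_iff algebra_simps sum.distrib)

lemma kernel_op_scale: "kernel_op Z Z' \<mu> (scale_fun a f) = scale_fun a (kernel_op Z Z' \<mu> f)"
  by (auto simp: kernel_op_def restr_def scale_fun_def fun_eq_iff sum_distrib_left algebra_simps)

lemma transition_operator_add:
  "transition_operator Z' Z L \<Longrightarrow> f \<in> fun_on Z' \<Longrightarrow> g \<in> fun_on Z' \<Longrightarrow> L (f + g) = L f + L g"
  by (metis transition_operator_def kernel_op_add fun_on_add)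

lemma transition_operator_scale:
  "transition_operator Z' Z L \<Longrightarrow> f \<in> fun_on Z' \<Longrightarrow> L (scale_fun a f) = scale_fun a (L f)"
  by (metis transition_operator_def kernel_op_scale fun_on_scale)

lemma A_op_add: "A_op S p c n (f + g) = A_op S p c n f + A_op S p c n g"
  by (simp add: A_op_def T_op_def kernel_op_add scale_fun_def fun_eq_iff algebra_simps)

lemma A_op_scale: "A_op S p c n (scale_fun a f) = scale_fun a (A_op S p c n f)"
  by (simp add: A_op_def T_op_def kernel_op_scale) (simp add: scale_fun_def fun_eq_iff algebra_simps)

context down_chains
begin

lemma ex1_U_value:
  assumes "f \<in> fun_on (S (Suc n))"
  shows "\<exists>!g. g \<in> fun_on (S n) \<and>
    scale_fun (c n) (D (Suc n) g) = A_op S p c (Suc n) f + scale_fun (c n) f"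
proof -
  have cn: "c n \<noteq> 0" using A1(1)[of n] by simp
  obtain g where g: "g \<in> fun_on (S n)" "D (Suc n) g = A_op S p c (Suc n) f + scale_fun (c n) f"
    using A3[of n] assms by (auto simp: image_subset_iff)
  show ?thesis
  proof (rule ex1I[of _ "scale_fun (1 / c n) g"], intro conjI)
    show "scale_fun (1 / c n) g \<in> fun_on (S n)" using g fun_on_scale by blast
    show "scale_fun (c n) (D (Suc n) (scale_fun (1 / c n) g)) = A_op S p c (Suc n) f + scale_fun (c n) f"
      using g cn by (simp add: transition_operator_scale[OF A2])
  next
    fix g' assume g': "g' \<in> fun_on (S n) \<and>
      scale_fun (c n) (D (Suc n) g') = A_op S p c (Suc n) f + scale_fun (c n) f"
    then have "D (Suc n) g' = D (Suc n) (scale_fun (1 / c n) g)"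
      using g cn by (metis transition_operator_scale[OF A2] fun_space.scale_scale
          fun_space.scale_one nonzero_divide_eq_eq)
    then show "g' = scale_fun (1 / c n) g"
      using A4[of n] g g' fun_on_scale by (blast dest: inj_onD)
  qed
qed

lemma ex1_U:
  "\<exists>!U. U \<in> linear_maps (fun_on (S (Suc n))) (fun_on (S n)) \<and>
     (\<forall>f\<in>fun_on (S (Suc n)).
        scale_fun (c n) (D (Suc n) (U f)) = A_op S p c (Suc n) f + scale_fun (c n) f)"
proof -
  define P where "P f g \<longleftrightarrow> g \<in> fun_on (S n) \<and>
    scale_fun (c n) (D (Suc n) g) = A_op S p c (Suc n) f + scale_fun (c n) f" for f g
  let ?V = "fun_on (S (Suc n))"
  have ex1: "\<exists>!g. P f g" if "f \<in> ?V" for f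
    using ex1_U_value[OF that] by (simp add: P_def)
  define L where "L = (\<lambda>f\<in>?V. THE g. P f g)"
  have PL: "P f (L f)" if "f \<in> ?V" for f
    using theI'[OF ex1[OF that]] that by (simp add: L_def)
  have L_eq: "L f = g" if "f \<in> ?V" "P f g" for f g
    using ex1[OF that(1)] PL[OF that(1)] that(2) by blast
  have "P (f + g) (L f + L g)" if "f \<in> ?V" "g \<in> ?V" for f g
    using PL[OF that(1)] PL[OF that(2)]
    by (simp add: P_def fun_on_add transition_operator_add[OF A2] fun_space.scale_right_distrib A_op_add)
  then have add: "L (f + g) = L f + L g" if "f \<in> ?V" "g \<in> ?V" for f g
    using that L_eq fun_on_add by blast
  have "P (scale_fun a f) (scale_fun a (L f))" if "f \<in> ?V" for f a
  proof -
    have "scale_fun (c n) (scale_fun a (D (Suc n) (L f))) = scale_fun a (scale_fun (c n) (D (Suc n) (L f)))"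
      by (simp add: mult.commute)
    then show ?thesis
      using PL[OF that]
      by (simp add: P_def fun_on_scale transition_operator_scale[OF A2] fun_space.scale_right_distrib
          A_op_scale mult.commute del: fun_space.scale_scale) (simp add: mult.commute)
  qed
  then have scale: "L (scale_fun a f) = scale_fun a (L f)" if "f \<in> ?V" for f a
    using that L_eq fun_on_scale by blast
  have L: "L \<in> linear_maps ?V (fun_on (S n))"
    using add scale PL by (auto simp: linear_maps_def P_def) (simp add: L_def)
  show ?thesis
  proof (rule ex1I[of _ L], intro conjI ballI)
    fix U assume U: "U \<in> linear_maps ?V (fun_on (S n)) \<and> (\<forall>f\<in>?V.
        scale_fun (c n) (D (Suc n) (U f)) = A_op S p c (Suc n) f + scale_fun (c n) f)"
    have "U f = L f" if "f \<in> ?V" for f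
    proof -
      have "U f \<in> fun_on (S n)"
        using U that by (auto simp: linear_maps_def)
      then show ?thesis using L_eq[OF that, of "U f"] U that by (simp add: P_def)
    qed
    then show "U = L" by (rule linear_maps_eqI[OF conjunct1[OF U] L])
  qed (use L PL in \<open>auto simp: P_def\<close>)
qed

lemma level_eq: "s \<in> S n \<Longrightarrow> level S s = n"
  unfolding level_def using A0_disjoint by (intro the_equality) auto

lemma finite_levels: "finite (\<Union>m\<le>k. S m)"
  using A0_finite by auto

lemma independent_d:
  assumes "\<And>u. (\<Sum>r\<in>(\<Union>m\<le>k. S m). b r * d_fun S D r u) = 0" "r \<in> S n" "n \<le> k"
  shows "b r = 0"
  using assms(2,3)
proof (induction n arbitrary: r rule: less_induct)
  case (less n)
  have "0 = (\<Sum>x\<in>(\<Union>m\<le>k. S m). b x * d_fun S D x r)" using assms(1) by simp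
  also have "\<dots> = (\<Sum>x\<in>{r}. b x * d_fun S D x r)"
  proof (rule sum.mono_neutral_right)
    show "\<forall>x\<in>(\<Union>m\<le>k. S m) - {r}. b x * d_fun S D x r = 0"
    proof
      fix x assume x: "x \<in> (\<Union>m\<le>k. S m) - {r}"
      then obtain m where m: "m \<le> k" "x \<in> S m" by auto
      consider "m < n" | "m = n" | "m > n" by linarith
      then show "b x * d_fun S D x r = 0"
      proof cases
        case 1 then show ?thesis using less.IH m by simp
      next
        case 2 then show ?thesis using m x less.prems
          by (auto simp: d_fun_def level_eq)
      next
        case 3 then show ?thesis using m less.prems by (auto simp: d_fun_def level_eq)
      qed
    qed
  qed (use less.prems finite_levels in auto)
  also have "\<dots> = b r" using less.prems by (auto simp: d_fun_def level_eq)
  finally show ?case by simp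
qed

lemma independent_h:
  assumes F: "finite F" "F \<subseteq> (\<Union>n. S n)" and z: "\<And>u. (\<Sum>s\<in>F. a s * h_fun S p c D s u) = 0"
    and "s \<in> F"
  shows "a s = 0"
proof (rule ccontr)
  assume "a s \<noteq> 0"
  define G where "G = {s\<in>F. a s \<noteq> 0}"
  have G: "finite G" "s \<in> G" "G \<subseteq> F" using F \<open>s \<in> F\<close> \<open>a s \<noteq> 0\<close> by (auto simp: G_def)
  define k where "k = Max (level S ` G)"
  have "k \<in> level S ` G" unfolding k_def using G by (intro Max_in) auto
  then obtain s' where s': "s' \<in> G" "level S s' = k" by auto
  have le: "level S x \<le> k" if "x \<in> G" for x using G that by (simp add: k_def)
  define w where "w r x = (if level S r \<le> level S x
    then p_up S p c D (level S r) (level S x) r x * eta c (level S r) (level S x) else 0)" for r x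
  let ?K = "\<Union>m\<le>k. S m"
  have mem: "x \<in> S (level S x)" if "x \<in> G" for x
    using that G(3) F(2) level_eq by fastforce
  have h: "h_fun S p c D x u = (\<Sum>r\<in>?K. w r x * d_fun S D r u)" if "x \<in> G" for x u
    unfolding h_fun_def
    by (rule sum.mono_neutral_cong_left)
       (use finite_levels le[OF that] order_trans[OF _ le[OF that]] in \<open>auto simp: w_def level_eq\<close>)
  have "(\<Sum>r\<in>?K. (\<Sum>x\<in>G. a x * w r x) * d_fun S D r u) = 0" for u
  proof -
    have "0 = (\<Sum>x\<in>G. a x * h_fun S p c D x u)"
      unfolding z[of u, symmetric] using F by (intro sum.mono_neutral_right) (auto simp: G_def)
    also have "\<dots> = (\<Sum>x\<in>G. \<Sum>r\<in>?K. a x * w r x * d_fun S D r u)"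
      by (simp add: h sum_distrib_left mult.assoc)
    also have "\<dots> = (\<Sum>r\<in>?K. \<Sum>x\<in>G. a x * w r x * d_fun S D r u)"
      by (rule sum.swap)
    finally show ?thesis by (simp add: sum_distrib_right)
  qed
  from independent_d[OF this mem[OF s'(1)]] s' have "0 = (\<Sum>x\<in>G. a x * w s' x)" by simp
  also have "\<dots> = (\<Sum>x\<in>{s'}. a x * w s' x)"
    by (rule sum.mono_neutral_right) (use s' le G in \<open>auto simp: w_def eta_def p_up_def le_antisym\<close>)
  also have "\<dots> = a s'" by (simp add: w_def eta_def p_up_def)
  finally show False using s' by (simp add: G_def)
qed

lemma sum_fun_apply: "(\<Sum>i\<in>I. f i) u = (\<Sum>i\<in>I. f i (u::'b))" for f :: "'i \<Rightarrow> 'b \<Rightarrow> real"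
  by (induction I rule: infinite_finite_induct) auto

lemma inj_h: "inj_on (h_fun S p c D) (\<Union>n. S n)"
proof (rule inj_onI, rule ccontr)
  fix s s' assume *: "s \<in> (\<Union>n. S n)" "s' \<in> (\<Union>n. S n)" "h_fun S p c D s = h_fun S p c D s'" "s \<noteq> s'"
  have "(if s = s then 1 else - 1) = (0::real)"
    by (rule independent_h[of "{s, s'}" "\<lambda>x. if x = s then 1 else - 1" s]) (use * in auto)
  then show False by simp
qed

lemma independent_h_image: "fun_space.independent (h_fun S p c D ` (\<Union>n. S n))"
  unfolding fun_space.independent_explicit_finite_subsets
proof (intro allI impI ballI)
  fix B w v
  assume B: "B \<subseteq> h_fun S p c D ` (\<Union>n. S n)" "finite B" "(\<Sum>v\<in>B. scale_fun (w v) v) = 0" "v \<in> B"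
  obtain F where F: "F \<subseteq> (\<Union>n. S n)" "finite F" "B = h_fun S p c D ` F"
    using finite_subset_image[OF B(2,1)] by blast
  obtain s where s: "s \<in> F" "v = h_fun S p c D s" using F B by auto
  have inj: "inj_on (h_fun S p c D) F" using inj_h F inj_on_subset by blast
  have "(\<Sum>s\<in>F. w (h_fun S p c D s) * h_fun S p c D s u) = 0" for u
    using fun_cong[OF B(3), of u] F inj
    by (simp add: sum.reindex sum_fun_apply scale_fun_def)
  from independent_h[OF F(2,1) this s(1)] s show "w v = 0" by simp
qed

lemma ex1_Q:
  "\<exists>!Q. Q \<in> linear_maps (H_space S p c D) (H_space S p c D) \<and>
     (\<forall>s\<in>(\<Union>n. S n). Q (h_fun S p c D s) =
        scale_fun (exp (- t * prev_rate c (level S s))) (h_fun S p c D s))"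
proof -
  let ?I = "\<Union>n. S n" and ?h = "h_fun S p c D" and ?H = "H_space S p c D"
  interpret pr: vector_space_pair "scale_fun :: real \<Rightarrow> ('a \<Rightarrow> real) \<Rightarrow> _"
    "scale_fun :: real \<Rightarrow> ('a \<Rightarrow> real) \<Rightarrow> _" by unfold_locales
  let ?e = "\<lambda>s. scale_fun (exp (- t * prev_rate c (level S s))) (?h s)"
  define L where "L = pr.construct (?h ` ?I) (\<lambda>b. ?e (inv_into ?I ?h b))"
  have lin: "Vector_Spaces.linear scale_fun scale_fun L"
    unfolding L_def by (rule pr.linear_construct[OF independent_h_image])
  interpret L: Vector_Spaces.linear "scale_fun :: real \<Rightarrow> ('a \<Rightarrow> real) \<Rightarrow> _"
    "scale_fun :: real \<Rightarrow> ('a \<Rightarrow> real) \<Rightarrow> _" L by (rule lin)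
  have Lh: "L (?h s) = ?e s" if "s \<in> ?I" for s
    unfolding L_def using that
    by (subst pr.construct_basis[OF independent_h_image]) (auto simp: inv_into_f_f[OF inj_h])
  have hH: "?h s \<in> ?H" if "s \<in> ?I" for s
    unfolding H_space_def using that by (intro fun_space.span_base) auto
  have sub: "fun_space.subspace ?H" by (simp add: H_space_def)
  have LH: "L f \<in> ?H" if "f \<in> ?H" for f
  proof -
    have "L f \<in> fun_space.span ((\<lambda>b. ?e (inv_into ?I ?h b)) ` ?h ` ?I)"
      unfolding L_def by (rule pr.construct_in_span[OF independent_h_image])
    moreover have "(\<lambda>b. ?e (inv_into ?I ?h b)) ` ?h ` ?I \<subseteq> ?H"
    proof
      fix g assume "g \<in> (\<lambda>b. ?e (inv_into ?I ?h b)) ` ?h ` ?I"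
      then obtain s where "s \<in> ?I" "g = ?e (inv_into ?I ?h (?h s))" by blast
      then show "g \<in> ?H"
        using hH sub by (simp only: inv_into_f_f[OF inj_h] fun_space.subspace_scale)
    qed
    ultimately show ?thesis using sub fun_space.span_minimal by blast
  qed
  let ?Q = "restrict L ?H"
  have Q: "?Q \<in> linear_maps ?H ?H"
    using LH sub by (auto simp: linear_maps_def L.add L.scale fun_space.subspace_add fun_space.subspace_scale)
  show ?thesis
  proof (rule ex1I[of _ ?Q], intro conjI ballI)
    fix Q assume Q': "Q \<in> linear_maps ?H ?H \<and> (\<forall>s\<in>?I. Q (?h s) = ?e s)"
    have add: "Q (f + g) = Q f + Q g" and scale: "Q (scale_fun a f) = scale_fun a (Q f)"
      if "f \<in> ?H" "g \<in> ?H" for f g a using Q' that by (auto simp: linear_maps_def)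
    have "f \<in> ?H \<and> Q f = L f" if "f \<in> ?H" for f
    proof -
      have "f \<in> fun_space.span (?h ` ?I)" using that by (simp add: H_space_def)
      then show ?thesis
      proof (induction rule: fun_space.span_induct_alt)
        case base
        have z: "0 \<in> ?H" using sub fun_space.subspace_0 by blast
        show ?case using scale[OF z z, of 0] z L.zero by (metis fun_space.scale_zero_left)
      next
        case (step a x y)
        then obtain s where s: "s \<in> ?I" "x = ?h s" by auto
        then have "x \<in> ?H" "scale_fun a x \<in> ?H" using hH sub fun_space.subspace_scale by auto
        moreover have "Q x = L x"
        proof -
          have "Q (?h s) = ?e s" using Q' s(1) by blast
          then show ?thesis using s Lh by simp
        qed
        moreover have "y \<in> ?H" "Q y = L y" using step by blast+
        ultimately show ?case using sub
          by (metis add scale L.add L.scale fun_space.subspace_add)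
      qed
    qed
    then have "Q f = ?Q f" if "f \<in> ?H" for f using that by simp
    then show "Q = ?Q" by (rule linear_maps_eqI[OF conjunct1[OF Q'] Q])
  qed (use Q Lh hH in auto)
qed

end

end

theory Submission
  imports Defs
begin

text \<open>
  On every level \<open>n \<ge> m = |s|\<close> the function \<open>h\<^sub>s\<close> is an eigenvector of \<open>A\<^sub>n\<close> for the eigenvalue
  \<open>-c\<^sub>m\<^sub>-\<^sub>1\<close>. Indeed, \<open>h\<^sub>s = \<Sum>\<^sub>j \<eta>\<^sub>j v\<^sub>j\<close> with \<open>v\<^sub>j = D\<^sub>n \<dots> D\<^sub>j\<^sub>+\<^sub>1 U\<^sub>j \<dots> U\<^sub>m\<^sub>-\<^sub>1 1\<^sub>s\<close>, and the
  intertwining relation (A5) together with the definition of \<open>U\<close> gives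
  \<open>A\<^sub>n v\<^sub>j = c\<^sub>j\<^sub>-\<^sub>1 (v\<^sub>j\<^sub>-\<^sub>1 - v\<^sub>j)\<close>; the weights \<open>\<eta>\<^sub>j\<close> solve the resulting recursion. Hence
  \<open>T\<^sub>n\<close> acts on \<open>h\<^sub>s\<close> by \<open>1 - c\<^sub>m\<^sub>-\<^sub>1 / c\<^sub>n\<close>, and since \<open>0 \<le> d\<^sub>r \<le> 1\<close> bounds \<open>h\<^sub>s\<close> uniformly
  in \<open>n\<close>, what is left is to compare the power of \<open>1 - x / c\<^sub>n\<close> with exponent \<open>\<lfloor>t c\<^sub>n\<rfloor>\<close> to \<open>exp (- t x)\<close>,
  where \<open>x = c\<^sub>m\<^sub>-\<^sub>1\<close>.
\<close>

section \<open>Comparison of a power with an exponential\<close>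

text \<open>From above, \<open>1 - x \<le> exp (- x)\<close> leaves only a factor
  \<open>exp (l / c)\<close> caused by rounding the exponent, an error of order
  \<open>1 / c\<close>. From below, the second-order term of the logarithm costs order
  \<open>t / c\<close>; \<open>max 1 t\<close> covers both. The bound \<open>b\<close> keeps
  \<open>l / c\<close> away from 1, so that one constant serves every
  \<open>c \<ge> b\<close>.\<close>

lemma power_floor_exp_bound:
  fixes l b c t :: real
  assumes "0 < l" "l < b" "b \<le> c" "0 \<le> t"
  shows "\<bar>(1 - l / c) ^ nat \<lfloor>t * c\<rfloor> - exp (- t * l)\<bar>
    \<le> max 1 t / c * (2 * l + l\<^sup>2 * b / (b - l)) * exp (- t * l)"
proof -
  define x where "x = l / c"
  define N where "N = nat \<lfloor>t * c\<rfloor>"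
  have c: "0 < c" using assms by linarith
  have x: "0 < x" "x < 1" using assms c by (auto simp: x_def)
  have xc: "x * c = l" using c by (simp add: x_def)
  have tc: "0 \<le> t * c" using assms c by simp
  have N: "real N \<le> t * c" "t * c - 1 \<le> real N"
    using tc unfolding N_def by linarith+
  have "(1 - x) ^ N \<le> exp (- x) ^ N"
    using x exp_ge_add_one_self[of "- x"] by (intro power_mono) auto
  also have "\<dots> = exp (- (x * real N))" by (simp add: exp_of_nat_mult [symmetric] mult.commute)
  also have "\<dots> \<le> exp (- t * l + x)"
  proof -
    have "x * (t * c - 1) \<le> x * real N" using x N by (intro mult_left_mono) auto
    moreover have "x * (t * c) = t * l" using xc by (metis mult.assoc mult.commute)
    ultimately have "t * l - x \<le> x * real N" unfolding right_diff_distrib by linarith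
    then show ?thesis by simp
  qed
  also have "\<dots> = exp x * exp (- t * l)" by (simp only: exp_add mult.commute)
  also have "\<dots> \<le> (1 + 2 * x) * exp (- t * l)"
  proof (rule mult_right_mono)
    have "exp x \<le> 1 + x + x\<^sup>2" using x by (intro exp_bound) auto
    moreover have "x\<^sup>2 \<le> x" using x by (simp add: power2_eq_square)
    ultimately show "exp x \<le> 1 + 2 * x" by linarith
  qed simp
  finally have up: "(1 - x) ^ N - exp (- t * l) \<le> 2 * x * exp (- t * l)"
    by (simp add: algebra_simps)
  \<comment> \<open>\<open>t * y / c\<close> will dominate the second-order loss
    \<open>t * c * x\<^sup>2 / (1 - x)\<close>: here \<open>c * x\<^sup>2 = l\<^sup>2 / c\<close>,
    and \<open>x \<le> l / b\<close> gives \<open>1 / (1 - x) \<le> b / (b - l)\<close>.\<close>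
  define y where "y = l\<^sup>2 * b / (b - l)"
  have y: "0 \<le> y" using assms by (simp add: y_def)
  \<comment> \<open>This is \<open>ln z \<le> z - 1\<close> at \<open>z = 1 / (1 - x)\<close>, which
    bounds the logarithm from below.\<close>
  have ln_ge: "- x - x * (x / (1 - x)) \<le> ln (1 - x)"
  proof -
    have "ln (1 / (1 - x)) \<le> 1 / (1 - x) - 1" using x by (intro ln_le_minus_one) auto
    moreover have "1 / (1 - x) - 1 = x + x * (x / (1 - x))" using x by (simp add: field_simps)
    moreover have "ln (1 / (1 - x)) = - ln (1 - x)" using x by (simp add: ln_div)
    ultimately show ?thesis by linarith
  qed
  have "t * y / c \<ge> t * c * (x * (x / (1 - x)))"
  proof -
    have "x \<le> l / b" using assms c by (simp add: x_def frac_le)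
    then have "1 / (1 - x) \<le> 1 / (1 - l / b)"
      using x assms by (intro divide_left_mono) auto
    also have "\<dots> = b / (b - l)" using assms by (simp add: field_simps)
    finally have "t * l * x * (1 / (1 - x)) \<le> t * l * x * (b / (b - l))"
      using assms x by (intro mult_left_mono) auto
    moreover have "t * l * x * (b / (b - l)) = t * y / c"
      by (simp add: y_def x_def power2_eq_square mult_ac)
    moreover have "t * c * (x * (x / (1 - x))) = t * l * x * (1 / (1 - x))"
      unfolding xc[symmetric] by simp
    ultimately show ?thesis by (simp only:)
  qed
  moreover have "t * c * (- x - x * (x / (1 - x))) = - t * l - t * c * (x * (x / (1 - x)))"
    unfolding xc[symmetric] by (simp add: algebra_simps)
  moreover have "t * c * (- x - x * (x / (1 - x))) \<le> t * c * ln (1 - x)"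
    using ln_ge tc by (rule mult_left_mono)
  \<comment> \<open>\<open>ln (1 - x)\<close> is negative, so rounding the exponent down only
    increases the product.\<close>
  moreover have "t * c * ln (1 - x) \<le> real N * ln (1 - x)"
    using N x by (intro mult_right_mono_neg) auto
  ultimately have "- t * l - t * y / c \<le> real N * ln (1 - x)" by linarith
  then have "exp (- t * l - t * y / c) \<le> exp (real N * ln (1 - x))" by simp
  also have "\<dots> = (1 - x) ^ N" using x by (simp add: exp_of_nat_mult)
  finally have "exp (- t * l) * exp (- (t * y / c)) \<le> (1 - x) ^ N"
    by (simp add: exp_add[symmetric])
  moreover have "exp (- t * l) * (1 - t * y / c) \<le> exp (- t * l) * exp (- (t * y / c))"
    using exp_ge_add_one_self[of "- (t * y / c)"] by (intro mult_left_mono) auto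
  ultimately have low: "exp (- t * l) - (1 - x) ^ N \<le> t * y / c * exp (- t * l)"
    by (simp add: algebra_simps)
  let ?M = "max 1 t / c"
  have M: "1 / c \<le> ?M" "t / c \<le> ?M" using c by (auto intro!: divide_right_mono)
  have "1 / c * (2 * l) \<le> ?M * (2 * l)" "t / c * y \<le> ?M * y"
    using M y assms by (intro mult_right_mono; simp)+
  moreover have "0 \<le> 1 / c * (2 * l)" "0 \<le> t / c * y" using c y assms by auto
  ultimately have "2 * x \<le> ?M * (2 * l + y)" "t * y / c \<le> ?M * (2 * l + y)"
    by (simp_all add: x_def distrib_left)
  then have "2 * x * exp (- t * l) \<le> ?M * (2 * l + y) * exp (- t * l)"
    "t * y / c * exp (- t * l) \<le> ?M * (2 * l + y) * exp (- t * l)"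
    by (intro mult_right_mono; simp)+
  then have "\<bar>(1 - x) ^ N - exp (- t * l)\<bar> \<le> ?M * (2 * l + y) * exp (- t * l)"
    using up low by linarith
  then show ?thesis by (simp only: x_def N_def y_def)
qed

section \<open>Linear combinations of functions on a level\<close>

lemma fun_on_indicator: "x \<in> Z \<Longrightarrow> indicator {x} \<in> fun_on Z"
  by (auto simp: fun_on_def indicator_def)

lemma fun_on_sum: "(\<And>i. i \<in> I \<Longrightarrow> w i \<in> fun_on Z) \<Longrightarrow> (\<lambda>u. \<Sum>i\<in>I. b i * w i u) \<in> fun_on Z"
  by (auto simp: fun_on_def intro!: sum.neutral)

lemma T_op_sum: "T_op S p n (\<lambda>u. \<Sum>i\<in>I. b i * w i u) = (\<lambda>u. \<Sum>i\<in>I. b i * T_op S p n (w i) u)"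
proof -
  have "(\<Sum>y\<in>S n. \<mu> y * (\<Sum>i\<in>I. b i * w i y)) = (\<Sum>i\<in>I. b i * (\<Sum>y\<in>S n. \<mu> y * w i y))" for \<mu>
  proof -
    have "(\<Sum>y\<in>S n. \<mu> y * (\<Sum>i\<in>I. b i * w i y)) = (\<Sum>y\<in>S n. \<Sum>i\<in>I. b i * (\<mu> y * w i y))"
      by (simp add: sum_distrib_left mult_ac)
    also have "\<dots> = (\<Sum>i\<in>I. \<Sum>y\<in>S n. b i * (\<mu> y * w i y))" by (rule sum.swap)
    finally show ?thesis by (simp add: sum_distrib_left)
  qed
  then show ?thesis by (auto simp: T_op_def kernel_op_def restr_def fun_eq_iff)
qed

lemma A_op_apply: "A_op S p c n f u = c n * (T_op S p n f u - f u)"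
  by (simp add: A_op_def scale_fun_def)

lemma A_op_sum: "A_op S p c n (\<lambda>u. \<Sum>i\<in>I. b i * w i u) u = (\<Sum>i\<in>I. b i * A_op S p c n (w i) u)"
proof -
  have "(\<Sum>i\<in>I. b i * (c n * (T_op S p n (w i) u - w i u)))
    = c n * (\<Sum>i\<in>I. b i * T_op S p n (w i) u - b i * w i u)"
    by (simp add: sum_distrib_left algebra_simps)
  then show ?thesis by (simp add: A_op_apply T_op_sum sum_subtractf)
qed

context down_chains
begin

section \<open>Monotone rates and iterated down-operators\<close>

abbreviation down :: "nat \<Rightarrow> nat \<Rightarrow> ('a \<Rightarrow> real) \<Rightarrow> 'a \<Rightarrow> real" where
  "down j n \<equiv> fold D [Suc j..<Suc n]"

text \<open>The order of composition is opposite to that of \<open>down\<close>: \<open>fold\<close>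
  there starts from the lowest level, \<open>foldr\<close> here from the highest.\<close>

abbreviation up :: "nat \<Rightarrow> nat \<Rightarrow> ('a \<Rightarrow> real) \<Rightarrow> 'a \<Rightarrow> real" where
  "up j m \<equiv> foldr (U_op S p c D) [j..<m]"

lemma c_pos: "0 < c n"
  by (rule A1)

lemma c_strict_mono: "strict_mono c"
  using A1(2) by (rule strict_monoI_Suc)

lemma prev_rate_strict_mono: "strict_mono (prev_rate c)"
proof (rule strict_monoI_Suc)
  show "prev_rate c n < prev_rate c (Suc n)" for n
    using A1 by (cases n) (auto simp: prev_rate_def)
qed

lemma D_fun_on: "f \<in> fun_on (S n) \<Longrightarrow> D (Suc n) f \<in> fun_on (S (Suc n))"
  using A2[of n] by (auto simp: transition_operator_def kernel_op_def restr_def fun_on_def)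

text \<open>On \<open>S (Suc n)\<close> the value is a weighted average of values of
  \<open>f\<close>; elsewhere it is 0, so \<open>u\<close> may be any point of the type.\<close>

lemma D_unit_interval:
  assumes "f \<in> fun_on (S n)" "\<And>u. 0 \<le> f u \<and> f u \<le> 1"
  shows "0 \<le> D (Suc n) f u \<and> D (Suc n) f u \<le> 1"
proof -
  obtain \<mu> where \<mu>: "stochastic (S (Suc n)) (S n) \<mu>" "D (Suc n) f = kernel_op (S (Suc n)) (S n) \<mu> f"
    using A2[of n] assms by (auto simp: transition_operator_def)
  have "0 \<le> (\<Sum>y\<in>S n. \<mu> u y * f y) \<and> (\<Sum>y\<in>S n. \<mu> u y * f y) \<le> (\<Sum>y\<in>S n. \<mu> u y)"
    if "u \<in> S (Suc n)"
    using \<mu>(1) that assms(2)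
    by (intro conjI sum_nonneg sum_mono mult_left_le) (auto simp: stochastic_def)
  then show ?thesis using \<mu> by (auto simp: kernel_op_def restr_def stochastic_def)
qed

lemma down_self: "down n n f = f"
  by simp

lemma down_Suc: "j \<le> n \<Longrightarrow> down j (Suc n) f = D (Suc n) (down j n f)"
  by simp

lemma down_Suc_left: "j < n \<Longrightarrow> down j n f = down (Suc j) n (D (Suc j) f)"
  by (simp add: upt_conv_Cons del: upt_Suc)

lemma down_fun_on: "j \<le> n \<Longrightarrow> f \<in> fun_on (S j) \<Longrightarrow> down j n f \<in> fun_on (S n)"
  by (induction n rule: dec_induct) (simp_all add: down_self down_Suc D_fun_on del: upt_Suc)

lemma down_add:
  "j \<le> n \<Longrightarrow> f \<in> fun_on (S j) \<Longrightarrow> g \<in> fun_on (S j) \<Longrightarrow> down j n (f + g) = down j n f + down j n g"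
  by (induction n rule: dec_induct)
    (simp_all add: down_self down_Suc transition_operator_add[OF A2] down_fun_on del: upt_Suc)

lemma down_scale:
  "j \<le> n \<Longrightarrow> f \<in> fun_on (S j) \<Longrightarrow> down j n (scale_fun a f) = scale_fun a (down j n f)"
  by (induction n rule: dec_induct)
    (simp_all add: down_self down_Suc transition_operator_scale[OF A2] down_fun_on del: upt_Suc)

lemma down_sum:
  assumes "finite I" "j \<le> n" "\<And>i. i \<in> I \<Longrightarrow> w i \<in> fun_on (S j)"
  shows "down j n (\<lambda>u. \<Sum>i\<in>I. b i * w i u) = (\<lambda>u. \<Sum>i\<in>I. b i * down j n (w i) u)"
  using assms(1,3)
proof (induction I)
  case empty
  \<comment> \<open>Homogeneity with scalar 0 shows that the zero function is mapped to
    zero.\<close>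
  have "down j n (scale_fun 0 (\<lambda>_. 0)) = scale_fun 0 (down j n (\<lambda>_. 0))"
    using assms(2) by (intro down_scale) (simp_all add: fun_on_def)
  then show ?case by (simp add: scale_fun_def del: upt_Suc)
next
  case (insert i I)
  have "(\<lambda>u. \<Sum>i\<in>insert i I. b i * w i u) = scale_fun (b i) (w i) + (\<lambda>u. \<Sum>i\<in>I. b i * w i u)"
    using insert.hyps by (auto simp: scale_fun_def)
  then have "down j n (\<lambda>u. \<Sum>i\<in>insert i I. b i * w i u)
    = down j n (scale_fun (b i) (w i) + (\<lambda>u. \<Sum>i\<in>I. b i * w i u))" by (rule arg_cong)
  also have "\<dots> = scale_fun (b i) (down j n (w i)) + down j n (\<lambda>u. \<Sum>i\<in>I. b i * w i u)"
    using insert.prems assms(2)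
    by (simp only: down_add down_scale fun_on_scale fun_on_sum insertI1 insertI2)
  also have "\<dots> = (\<lambda>u. \<Sum>i\<in>insert i I. b i * down j n (w i) u)"
    using insert by (auto simp: scale_fun_def simp del: upt_Suc)
  finally show ?case .
qed

lemma down_unit_interval:
  assumes "j \<le> n" "f \<in> fun_on (S j)" "\<And>u. 0 \<le> f u \<and> f u \<le> 1"
  shows "0 \<le> down j n f u \<and> down j n f u \<le> 1"
  using assms(1)
proof (induction n arbitrary: u rule: dec_induct)
  case base
  then show ?case using assms by simp
next
  case (step n)
  then show ?case
    using D_unit_interval[OF down_fun_on[OF step.hyps(1) assms(2)]] by (simp add: down_Suc)
qed

text \<open>Iteration of (A5). As (A5) speaks only of \<open>fun_on\<close>, each step uses that the
  intermediate function lives on its level.\<close>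

lemma A_op_down:
  "j \<le> n \<Longrightarrow> f \<in> fun_on (S j) \<Longrightarrow> A_op S p c n (down j n f) = down j n (A_op S p c j f)"
proof (induction n rule: dec_induct)
  case base
  then show ?case by simp
next
  case (step n)
  then show ?case using A5 down_fun_on by (simp add: down_Suc del: upt_Suc)
qed

lemma d_fun_eq_down:
  "r \<in> S j \<Longrightarrow> u \<in> S n \<Longrightarrow> j \<le> n \<Longrightarrow> d_fun S D r u = down j n (indicator {r}) u"
  by (auto simp: d_fun_def level_eq)

lemma d_fun_unit_interval: "s \<in> (\<Union>n. S n) \<Longrightarrow> 0 \<le> d_fun S D s u \<and> d_fun S D s u \<le> 1"
proof -
  assume "s \<in> (\<Union>n. S n)"
  then obtain j where j: "s \<in> S j" by auto
  show ?thesis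
  proof (cases "\<exists>n. u \<in> S n \<and> j \<le> n")
    case True
    then obtain n where n: "u \<in> S n" "j \<le> n" by auto
    show ?thesis unfolding d_fun_eq_down[OF j n]
      by (rule down_unit_interval) (use j n in \<open>auto simp: fun_on_indicator indicator_def\<close>)
  next
    \<comment> \<open>Here \<open>u\<close> lies below level \<open>j\<close> or on no level, where
      \<open>d_fun\<close> has its default value 0.\<close>
    case False
    then show ?thesis using j by (auto simp: d_fun_def level_eq)
  qed
qed

text \<open>Expand \<open>f\<close> in indicators of points of \<open>S j\<close>;
  \<open>down\<close> carries these to the functions \<open>d_fun S D r\<close>. This links the
  kernel sum defining \<open>h_fun\<close> to compositions of operators.\<close>

lemma down_expand:
  assumes "j \<le> n" "f \<in> fun_on (S j)" "u \<in> S n"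
  shows "down j n f u = (\<Sum>r\<in>S j. f r * d_fun S D r u)"
proof -
  have "f = (\<lambda>u. \<Sum>r\<in>S j. f r * indicator {r} u)"
  proof
    fix u show "f u = (\<Sum>r\<in>S j. f r * indicator {r} u)"
      using assms(2) A0_finite[of j] by (cases "u \<in> S j") (auto simp: fun_on_def indicator_def Int_insert_right)
  qed
  then have "down j n f u = down j n (\<lambda>u. \<Sum>r\<in>S j. f r * indicator {r} u) u" by metis
  also have "\<dots> = (\<Sum>r\<in>S j. f r * down j n (indicator {r}) u)"
    using assms A0_finite by (subst down_sum) (auto simp: fun_on_indicator)
  finally show ?thesis using assms by (simp add: d_fun_eq_down del: upt_Suc)
qed

section \<open>Up-operators\<close>

lemma U_op_props:
  assumes "f \<in> fun_on (S (Suc n))"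
  shows "U_op S p c D n f \<in> fun_on (S n)"
    and "scale_fun (c n) (D (Suc n) (U_op S p c D n f)) = A_op S p c (Suc n) f + scale_fun (c n) f"
  using theI'[OF ex1_U[of n], folded U_op_def] assms by (auto simp: linear_maps_def)

lemma up_left: "j < m \<Longrightarrow> up j m f = U_op S p c D j (up (Suc j) m f)"
  by (simp add: upt_conv_Cons)

lemma up_fun_on: "j \<le> m \<Longrightarrow> f \<in> fun_on (S m) \<Longrightarrow> up j m f \<in> fun_on (S j)"
  by (induction j rule: inc_induct) (simp_all add: up_left U_op_props)

text \<open>The defining equation of \<open>U_op S p c D j\<close>, taken at
  \<open>up (Suc j) m f\<close> and solved for the generator.\<close>

lemma A_op_up:
  assumes "j < m" "f \<in> fun_on (S m)"
  shows "A_op S p c (Suc j) (up (Suc j) m f)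
    = scale_fun (c j) (D (Suc j) (up j m f)) + scale_fun (- c j) (up (Suc j) m f)"
  using U_op_props(2)[OF up_fun_on[of "Suc j" m f]] assms
  by (simp add: up_left fun_space.scale_minus_left)

text \<open>On a single point a stochastic matrix is the identity. This starts the recursion for the
  eigenvalue equation.\<close>

lemma A_op_root: "f \<in> fun_on (S 0) \<Longrightarrow> A_op S p c 0 f = (\<lambda>_. 0)"
proof -
  assume f: "f \<in> fun_on (S 0)"
  obtain z where "S 0 = {z}" using A0_root by (auto simp: is_singleton_def)
  then show ?thesis using f chain[of 0]
    by (auto simp: A_op_apply T_op_def kernel_op_def restr_def stochastic_def fun_on_def fun_eq_iff)
qed

section \<open>The eigenvalue equation\<close>

text \<open>Split off the first factor of the product; its denominator is nonzero because
  \<open>prev_rate c\<close> is strictly increasing.\<close>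

lemma eta_left:
  assumes "j < m"
  shows "eta c (Suc j) m * c j = eta c j m * (prev_rate c j - prev_rate c m)"
proof -
  have "prev_rate c j < prev_rate c m" using prev_rate_strict_mono assms by (auto dest: strict_monoD)
  then show ?thesis using assms by (simp add: eta_def prod.atLeast_Suc_lessThan)
qed

text \<open>Group the sum over \<open>r\<close> by levels; the inner sum over \<open>S j\<close> is
  then an instance of \<open>down_expand\<close>.\<close>

lemma h_fun_eq_down:
  assumes "s \<in> S m" "m \<le> n" "u \<in> S n"
  shows "h_fun S p c D s u = (\<Sum>j\<le>m. eta c j m * down j n (up j m (indicator {s})) u)"
proof -
  have "h_fun S p c D s u
    = (\<Sum>j\<le>m. \<Sum>r\<in>S j. p_up S p c D (level S r) m r s * eta c (level S r) m * d_fun S D r u)"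
    using assms A0_finite A0_disjoint
    by (simp add: h_fun_def level_eq sum.UNION_disjoint)
  also have "\<dots> = (\<Sum>j\<le>m. eta c j m * (\<Sum>r\<in>S j. up j m (indicator {s}) r * d_fun S D r u))"
    by (simp add: level_eq p_up_def sum_distrib_left mult_ac)
  also have "\<dots> = (\<Sum>j\<le>m. eta c j m * down j n (up j m (indicator {s})) u)"
    using assms by (intro sum.cong refl) (auto simp: down_expand up_fun_on fun_on_indicator simp del: upt_Suc)
  finally show ?thesis .
qed

lemma A_op_h_fun:
  assumes "s \<in> S m" "m \<le> n"
  shows "A_op S p c n (restr (S n) (h_fun S p c D s))
    = scale_fun (- prev_rate c m) (restr (S n) (h_fun S p c D s))"
proof
  fix u
  define g where "g j = up j m (indicator {s})" for j
  define v where "v j = down j n (g j)" for j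
  have g: "g j \<in> fun_on (S j)" if "j \<le> m" for j
    unfolding g_def using that assms by (intro up_fun_on fun_on_indicator)
  have v: "v j \<in> fun_on (S n)" if "j \<le> m" for j
    unfolding v_def using that assms g by (intro down_fun_on) auto
  have h: "restr (S n) (h_fun S p c D s) = (\<lambda>u. \<Sum>j\<le>m. eta c j m * v j u)"
  proof
    fix u
    \<comment> \<open>Both sides vanish off \<open>S n\<close>, so they agree on the whole
      type.\<close>
    have "\<forall>j\<le>m. v j u = 0" if "u \<notin> S n" using v that by (auto simp: fun_on_def)
    then show "restr (S n) (h_fun S p c D s) u = (\<Sum>j\<le>m. eta c j m * v j u)"
      using h_fun_eq_down[OF assms] by (auto simp: restr_def v_def g_def simp del: upt_Suc)
  qed
  have A0: "A_op S p c n (v 0) u = 0"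
  proof -
    have "A_op S p c n (v 0) = down 0 n (A_op S p c 0 (g 0))"
      unfolding v_def by (rule A_op_down) (auto simp: g)
    \<comment> \<open>The zero function is written as an empty sum so that \<open>down_sum\<close>
      evaluates \<open>down\<close> on it.\<close>
    also have "\<dots> = down 0 n (\<lambda>u. \<Sum>i\<in>({} :: nat set). 0 * 0)" using g by (simp add: A_op_root del: upt_Suc)
    also have "\<dots> = (\<lambda>_. 0)" by (subst down_sum[where w = "\<lambda>_ _. 0"]) auto
    finally show ?thesis by simp
  qed
  have A_Suc: "A_op S p c n (v (Suc j)) u = c j * (v j u - v (Suc j) u)" if "j < m" for j
  proof -
    have gj: "g j \<in> fun_on (S j)" "g (Suc j) \<in> fun_on (S (Suc j))" using g that by auto
    note D = D_fun_on[OF gj(1)]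
    have jn: "Suc j \<le> n" using that assms by simp
    have "A_op S p c n (v (Suc j)) = down (Suc j) n (A_op S p c (Suc j) (g (Suc j)))"
      unfolding v_def using jn gj by (intro A_op_down)
    also have "A_op S p c (Suc j) (g (Suc j))
      = scale_fun (c j) (D (Suc j) (g j)) + scale_fun (- c j) (g (Suc j))"
      unfolding g_def using that assms by (intro A_op_up fun_on_indicator)
    also have "down (Suc j) n \<dots>
      = scale_fun (c j) (down (Suc j) n (D (Suc j) (g j))) + scale_fun (- c j) (v (Suc j))"
      using jn D gj by (simp only: down_add down_scale fun_on_scale v_def)
    also have "down (Suc j) n (D (Suc j) (g j)) = v j"
      using jn by (simp add: v_def down_Suc_left del: upt_Suc)
    finally show ?thesis by (simp add: scale_fun_def algebra_simps)
  qed
  \<comment> \<open>The sum telescopes. When term \<open>Suc i\<close> is added, its multiple of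
    \<open>v i\<close> cancels the previous remainder by \<open>eta_left\<close>, and a multiple of
    \<open>v (Suc i)\<close> remains. At \<open>i = m\<close> the factor
    \<open>prev_rate c m - prev_rate c i\<close> vanishes, which is the eigenvalue equation. The
    base case relies on \<open>prev_rate c 0 = 0\<close>.\<close>
  have partial: "(\<Sum>j\<le>i. eta c j m * A_op S p c n (v j) u) + prev_rate c m * (\<Sum>j\<le>i. eta c j m * v j u)
    = eta c i m * (prev_rate c m - prev_rate c i) * v i u" if "i \<le> m" for i
    using that
  proof (induction i)
    case 0
    then show ?case by (simp add: A0 prev_rate_def)
  next
    case (Suc i)
    then have i: "i < m" by simp
    note IH = Suc.IH[OF less_imp_le[OF i]]
    have "prev_rate c (Suc i) = c i" by (simp add: prev_rate_def)
    then have "(\<Sum>j\<le>Suc i. eta c j m * A_op S p c n (v j) u) + prev_rate c m * (\<Sum>j\<le>Suc i. eta c j m * v j u)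
      = eta c i m * (prev_rate c m - prev_rate c i) * v i u + eta c (Suc i) m * c i * v i u
        + eta c (Suc i) m * (prev_rate c m - prev_rate c (Suc i)) * v (Suc i) u"
      unfolding IH[symmetric] sum.atMost_Suc A_Suc[OF i] by (simp add: algebra_simps)
    then show ?case unfolding eta_left[OF i] by (simp add: algebra_simps)
  qed
  show "A_op S p c n (restr (S n) (h_fun S p c D s)) u
    = scale_fun (- prev_rate c m) (restr (S n) (h_fun S p c D s)) u"
    using partial[of m] by (simp add: h A_op_sum scale_fun_def)
qed

lemma T_op_h_fun:
  assumes "s \<in> S m" "m \<le> n"
  shows "T_op S p n (restr (S n) (h_fun S p c D s)) u
    = (1 - prev_rate c m / c n) * restr (S n) (h_fun S p c D s) u"
  using fun_cong[OF A_op_h_fun[OF assms], of u] c_pos[of n]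
  by (simp add: A_op_apply scale_fun_def field_simps)

section \<open>Powers of the transition operator and the limiting operator on linear
  combinations\<close>

lemma T_op_power_h_sum:
  assumes "k \<le> n"
  shows "(T_op S p n ^^ N) (restr (S n) (\<lambda>u. \<Sum>s\<in>(\<Union>m\<le>k. S m). a s * h_fun S p c D s u))
    = restr (S n) (\<lambda>u. \<Sum>s\<in>(\<Union>m\<le>k. S m).
        a s * (1 - prev_rate c (level S s) / c n) ^ N * h_fun S p c D s u)"
proof (induction N)
  case 0
  then show ?case by simp
next
  case (Suc N)
  let ?K = "\<Union>m\<le>k. S m" and ?h = "\<lambda>s. restr (S n) (h_fun S p c D s)"
  let ?x = "\<lambda>s. 1 - prev_rate c (level S s) / c n"
  \<comment> \<open>The restriction moves inside the sum because the eigenvalue relation concerns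
    the restricted functions.\<close>
  have restr_sum: "restr (S n) (\<lambda>u. \<Sum>s\<in>?K. b s * h_fun S p c D s u) = (\<lambda>u. \<Sum>s\<in>?K. b s * ?h s u)" for b
    by (auto simp: restr_def)
  have "T_op S p n (?h s) u = ?x s * ?h s u" if "s \<in> ?K" for s u
    using that assms T_op_h_fun by (auto simp: level_eq)
  then have "T_op S p n (restr (S n) (\<lambda>u. \<Sum>s\<in>?K. a s * ?x s ^ N * h_fun S p c D s u))
    = restr (S n) (\<lambda>u. \<Sum>s\<in>?K. a s * ?x s ^ Suc N * h_fun S p c D s u)"
    unfolding restr_sum T_op_sum by (intro ext sum.cong) (simp_all add: mult_ac)
  then show ?case by (simp only: funpow.simps comp_apply Suc.IH)
qed

text \<open>Linearity of \<open>Q_op\<close> is known only on \<open>H_space\<close>, so the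
  induction over finite index sets carries along that the partial sums belong to it.\<close>

lemma Q_op_h_sum:
  "Q_op S p c D t (\<lambda>u. \<Sum>s\<in>(\<Union>m\<le>k. S m). a s * h_fun S p c D s u)
    = (\<lambda>u. \<Sum>s\<in>(\<Union>m\<le>k. S m). a s * exp (- t * prev_rate c (level S s)) * h_fun S p c D s u)"
proof -
  let ?Q = "Q_op S p c D t" and ?H = "H_space S p c D" and ?h = "h_fun S p c D"
  have Q: "?Q \<in> linear_maps ?H ?H"
    and Qh: "\<And>s. s \<in> (\<Union>n. S n) \<Longrightarrow> ?Q (?h s) = scale_fun (exp (- t * prev_rate c (level S s))) (?h s)"
    using theI'[OF ex1_Q[of t], folded Q_op_def] by auto
  have add: "?Q (f + g) = ?Q f + ?Q g" and scale: "?Q (scale_fun b f) = scale_fun b (?Q f)"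
    if "f \<in> ?H" "g \<in> ?H" for f g b using Q that by (auto simp: linear_maps_def)
  have H: "fun_space.subspace ?H" by (simp add: H_space_def)
  have hH: "?h s \<in> ?H" if "s \<in> (\<Union>n. S n)" for s
    unfolding H_space_def using that by (intro fun_space.span_base) auto
  have z: "0 \<in> ?H" using H by (rule fun_space.subspace_0)
  have Q0: "?Q 0 = 0" using scale[OF z z, of 0] by (simp only: fun_space.scale_zero_left)
  have "(\<Sum>s\<in>F. scale_fun (a s) (?h s)) \<in> ?H \<and> ?Q (\<Sum>s\<in>F. scale_fun (a s) (?h s))
      = (\<Sum>s\<in>F. scale_fun (a s * exp (- t * prev_rate c (level S s))) (?h s))"
    if "finite F" "F \<subseteq> (\<Union>n. S n)" for F
    using that
  proof (induction F)
    case empty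
    then show ?case using z Q0 by (simp only: sum.empty)
  next
    case (insert s F)
    have hs: "?h s \<in> ?H" "scale_fun (a s) (?h s) \<in> ?H"
      using hH insert.prems H fun_space.subspace_scale by auto
    have IH: "(\<Sum>s\<in>F. scale_fun (a s) (?h s)) \<in> ?H" "?Q (\<Sum>s\<in>F. scale_fun (a s) (?h s))
      = (\<Sum>s\<in>F. scale_fun (a s * exp (- t * prev_rate c (level S s))) (?h s))"
      using insert by auto
    have "?Q (?h s) = scale_fun (exp (- t * prev_rate c (level S s))) (?h s)"
      using insert.prems by (intro Qh) auto
    then show ?case
      using IH hs scale[OF hs(1,1)]
      by (simp only: sum.insert[OF insert.hyps] add fun_space.subspace_add[OF H] fun_space.scale_scale simp_thms)
  qed
  then have "?Q (\<Sum>s\<in>(\<Union>m\<le>k. S m). scale_fun (a s) (?h s))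
      = (\<Sum>s\<in>(\<Union>m\<le>k. S m). scale_fun (a s * exp (- t * prev_rate c (level S s))) (?h s))"
    using finite_levels[of k] by blast
  moreover have "(\<Sum>s\<in>F. scale_fun (b s) (?h s)) = (\<lambda>u. \<Sum>s\<in>F. b s * ?h s u)" for F b
    by (rule ext) (simp add: sum_fun_apply scale_fun_def)
  ultimately show ?thesis by (simp only:)
qed

section \<open>Constants and the final estimate\<close>

text \<open>As \<open>d_fun\<close> takes values between 0 and 1, the sum of the absolute
  coefficients bounds \<open>h_fun S p c D s\<close> at every point, hence on all levels at
  once.\<close>

definition h_bound :: "'a \<Rightarrow> real" where
  "h_bound s = (\<Sum>r\<in>(\<Union>m\<le>level S s. S m).
     \<bar>p_up S p c D (level S r) (level S s) r s * eta c (level S r) (level S s)\<bar>)"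

lemma h_bound_nonneg: "0 \<le> h_bound s"
  by (simp add: h_bound_def sum_nonneg)

lemma h_fun_le_h_bound: "\<bar>h_fun S p c D s u\<bar> \<le> h_bound s"
  unfolding h_fun_def h_bound_def
proof (rule order_trans[OF sum_abs], rule sum_mono)
  fix r assume "r \<in> (\<Union>m\<le>level S s. S m)"
  then have "0 \<le> d_fun S D r u" "d_fun S D r u \<le> 1" using d_fun_unit_interval[of r u] by auto
  then show "\<bar>p_up S p c D (level S r) (level S s) r s * eta c (level S r) (level S s) * d_fun S D r u\<bar>
    \<le> \<bar>p_up S p c D (level S r) (level S s) r s * eta c (level S r) (level S s)\<bar>"
    by (simp add: abs_mult mult_left_le)
qed

text \<open>Needed to bound the supremum in \<open>sup_norm\<close> pointwise. Onto an empty level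
  \<open>D (Suc n)\<close> would send everything to zero, against injectivity on a nonempty
  \<open>S n\<close>.\<close>

lemma S_nonempty: "S n \<noteq> {}"
proof (induction n)
  case 0
  then show ?case using A0_root by (auto simp: is_singleton_def)
next
  case (Suc n)
  then obtain x where x: "x \<in> S n" by auto
  show ?case
  proof
    assume "S (Suc n) = {}"
    then have "D (Suc n) f = (\<lambda>_. 0)" if "f \<in> fun_on (S n)" for f
      using D_fun_on[OF that] by (auto simp: fun_on_def)
    moreover have "(\<lambda>_. 0) \<in> fun_on (S n)" by (simp add: fun_on_def)
    ultimately have "indicator {x} = (\<lambda>_. 0 :: real)"
      using A4[of n] fun_on_indicator[OF x] by (metis inj_onD)
    then show False by (simp add: fun_eq_iff indicator_def split: if_splits)
  qed
qed

text \<open>The constant of \<open>power_floor_exp_bound\<close> with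
  \<open>l = prev_rate c m\<close> and \<open>b = c m\<close>, the smallest rate \<open>c n\<close>
  with \<open>n \<ge> m\<close>. Summing \<open>h_bound\<close> over the level removes the
  dependence on the single point \<open>s\<close>.\<close>

definition rate_const :: "nat \<Rightarrow> real" where
  "rate_const m = (2 * prev_rate c m + (prev_rate c m)\<^sup>2 * c m / (c m - prev_rate c m)) * (\<Sum>s\<in>S m. h_bound s)"

lemma rate_bound:
  assumes "s \<in> S m" "1 \<le> m" "m \<le> n" "0 \<le> t"
  shows "\<bar>(1 - prev_rate c m / c n) ^ nat \<lfloor>t * c n\<rfloor> - exp (- t * prev_rate c m)\<bar> * \<bar>h_fun S p c D s u\<bar>
    \<le> max 1 t / c n * (rate_const m * exp (- t * prev_rate c m))"
proof -
  let ?l = "prev_rate c m"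
  \<comment> \<open>\<open>1 \<le> m\<close> ensures a positive \<open>prev_rate c m\<close>; at
    level 0 it would be 0.\<close>
  have l: "0 < ?l" "?l < c m"
    using assms(2) A1 by (auto simp: prev_rate_def split: nat.split)
  have "c m \<le> c n" using c_strict_mono assms(3) by (simp add: strict_mono_less_eq)
  note b = power_floor_exp_bound[OF l this assms(4)]
  have "\<bar>h_fun S p c D s u\<bar> \<le> (\<Sum>s\<in>S m. h_bound s)"
    using assms(1) A0_finite h_bound_nonneg
    by (intro order_trans[OF h_fun_le_h_bound] member_le_sum) auto
  from mult_mono[OF b this] order_trans[OF abs_ge_zero b] show ?thesis
    by (simp add: rate_const_def mult_ac)
qed

lemma sup_norm_T_power_minus_Q:
  assumes f: "f = (\<lambda>u. \<Sum>s\<in>(\<Union>m\<le>k. S m). a s * h_fun S p c D s u)" and t: "0 \<le> t" and k: "k \<le> n"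
  shows "sup_norm (S n) ((T_op S p n ^^ nat \<lfloor>t * c n\<rfloor>) (restr (S n) f) - restr (S n) (Q_op S p c D t f))
    \<le> max 1 t / c n *
       (\<Sum>s\<in>(\<Union>m\<in>{1..k}. S m). \<bar>a s\<bar> * rate_const (level S s) * exp (- t * prev_rate c (level S s)))"
  unfolding sup_norm_def
proof (rule cSUP_least[OF S_nonempty])
  fix u assume u: "u \<in> S n"
  let ?N = "nat \<lfloor>t * c n\<rfloor>" and ?K = "\<Union>m\<le>k. S m" and ?K1 = "\<Union>m\<in>{1..k}. S m"
  let ?P = "\<lambda>s. prev_rate c (level S s)" and ?h = "h_fun S p c D"
  let ?e = "\<lambda>s. (1 - ?P s / c n) ^ ?N - exp (- t * ?P s)"
  have "((T_op S p n ^^ ?N) (restr (S n) f) - restr (S n) (Q_op S p c D t f)) u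
    = (\<Sum>s\<in>?K. a s * ?e s * ?h s u)"
    unfolding f T_op_power_h_sum[OF k] Q_op_h_sum using u
    by (simp add: restr_def sum_subtractf[symmetric] algebra_simps)
  also have "\<dots> = (\<Sum>s\<in>?K1. a s * ?e s * ?h s u)"
  proof (rule sum.mono_neutral_right)
    \<comment> \<open>Level 0 drops out: its rate is 0, so the power and the exponential are both
      1.\<close>
    show "\<forall>s\<in>?K - ?K1. a s * ?e s * ?h s u = 0"
    proof
      fix s assume s: "s \<in> ?K - ?K1"
      then obtain m where m: "s \<in> S m" "m \<le> k" by auto
      then have "m = 0" using s by (cases m) auto
      then show "a s * ?e s * ?h s u = 0" using m by (simp add: level_eq prev_rate_def)
    qed
  qed (use finite_levels in auto)
  finally have "\<bar>((T_op S p n ^^ ?N) (restr (S n) f) - restr (S n) (Q_op S p c D t f)) u\<bar>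
    \<le> (\<Sum>s\<in>?K1. \<bar>a s\<bar> * (\<bar>?e s\<bar> * \<bar>?h s u\<bar>))"
    by (simp only: sum_abs abs_mult[symmetric] mult.assoc)
  also have "\<dots> \<le> (\<Sum>s\<in>?K1. \<bar>a s\<bar> * (max 1 t / c n * (rate_const (level S s) * exp (- t * ?P s))))"
  proof (intro sum_mono mult_left_mono)
    fix s assume "s \<in> ?K1"
    then obtain m where "s \<in> S m" "1 \<le> m" "m \<le> k" by auto
    then show "\<bar>?e s\<bar> * \<bar>?h s u\<bar> \<le> max 1 t / c n * (rate_const (level S s) * exp (- t * ?P s))"
      using rate_bound[of s m n t u] t k by (simp add: level_eq)
  qed simp
  also have "\<dots> = max 1 t / c n * (\<Sum>s\<in>?K1. \<bar>a s\<bar> * rate_const (level S s) * exp (- t * ?P s))"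
    by (simp add: sum_distrib_left mult_ac)
  finally show "\<bar>((T_op S p n ^^ ?N) (restr (S n) f) - restr (S n) (Q_op S p c D t f)) u\<bar>
    \<le> max 1 t / c n * (\<Sum>s\<in>?K1. \<bar>a s\<bar> * rate_const (level S s) * exp (- t * ?P s))" .
qed

end

theorem proposition3p18:
  fixes S :: "nat \<Rightarrow> 'a set"
    and p :: "nat \<Rightarrow> 'a \<Rightarrow> 'a \<Rightarrow> real"
    and c :: "nat \<Rightarrow> real"
    and D :: "nat \<Rightarrow> ('a \<Rightarrow> real) \<Rightarrow> 'a \<Rightarrow> real"
  assumes "down_chains S p c D"
  shows "\<exists>q :: nat \<Rightarrow> real. \<forall>(k::nat) (a :: 'a \<Rightarrow> real) (f :: 'a \<Rightarrow> real) (t::real) (n::nat).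
    f = (\<lambda>u. \<Sum>s\<in>(\<Union>m\<le>k. S m). a s * h_fun S p c D s u) \<and> 0 \<le> t \<and> k \<le> n \<longrightarrow>
    sup_norm (S n)
      ((T_op S p n ^^ nat \<lfloor>t * c n\<rfloor>) (restr (S n) f) - restr (S n) (Q_op S p c D t f))
    \<le> max 1 t / c n *
       (\<Sum>s\<in>(\<Union>m\<in>{1..k}. S m).
          \<bar>a s\<bar> * q (level S s) * exp (- t * prev_rate c (level S s)))"
  \<comment> \<open>The witness for \<open>q\<close> is \<open>rate_const\<close>, which involves
    none of \<open>k\<close>, \<open>a\<close>, \<open>f\<close>, \<open>t\<close> and
    \<open>n\<close>.\<close>
  using down_chains.sup_norm_T_power_minus_Q[OF assms] by blast

end
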